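(* Let $k\ge 1$ and $n\ge k(k+1)^2+1$. Then the Kneser graph $K(n,k)$ has no complete conflict-free coloring with $k+1$ colors; that is, $\chi_{CF}(K(n,k))\ge k+2$.
   Context: The Kneser graph $K(n,k)$ has as vertices the $k$-element subsets of $\{1,\dots,n\}$, two being adjacent iff they are disjoint. A complete conflict-free coloring with $m$ colors is a map $C:V\to\{1,\dots,m\}$ such that every vertex $v$ has some color $i$ with $|N(v)\cap C^{-1}(i)|=1$, where $N(v)$ is the open neighborhood; $\chi_{CF}$ is the minimum such $m$. *)

theory Defs
  imports Main
begin

text \<open>A graph is given by its vertex set \<open>V\<close> and its set \<open>E\<close> of edges, each edge being the
  unordered pair of its endpoints.\<close>

definition open_nbhd :: "'a set \<Rightarrow> 'a set set \<Rightarrow> 'a \<Rightarrow> 'a set" where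
  "open_nbhd V E v = {u \<in> V. {v, u} \<in> E}"

definition cf_coloring :: "'a set \<Rightarrow> 'a set set \<Rightarrow> nat \<Rightarrow> ('a \<Rightarrow> nat) \<Rightarrow> bool" where
  "cf_coloring V E m C \<longleftrightarrow>
     C ` V \<subseteq> {1..m} \<and>
     (\<forall>v\<in>V. \<exists>i\<in>{1..m}. card (open_nbhd V E v \<inter> C -` {i}) = 1)"

text \<open>On \<open>nat\<close>, the infimum of a nonempty set is its minimum, and \<open>Inf {} = 0\<close>. So a positive
  lower bound on \<open>chi_CF\<close> also says that a complete conflict-free coloring exists.\<close>

definition chi_CF :: "'a set \<Rightarrow> 'a set set \<Rightarrow> nat" where
  "chi_CF V E = Inf {m. \<exists>C. cf_coloring V E m C}"

definition kneser_verts :: "nat \<Rightarrow> nat \<Rightarrow> nat set set" where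
  "kneser_verts n k = {A. A \<subseteq> {1..n} \<and> card A = k}"

text \<open>For \<open>k \<ge> 1\<close> disjoint vertices are distinct, so there are no loops.\<close>

definition kneser_edges :: "nat \<Rightarrow> nat \<Rightarrow> nat set set set" where
  "kneser_edges n k =
     {{A, B} | A B. A \<in> kneser_verts n k \<and> B \<in> kneser_verts n k \<and> A \<inter> B = {}}"

end

theory Submission
  imports Defs
begin

text \<open>Suppose \<open>C\<close> is a conflict-free coloring with \<open>k + 1\<close> colors. Call a color dead for a set
  \<open>S\<close> of points if \<open>S\<close> meets every vertex of that color. Start from \<open>S = {}\<close> and, as long
  as some color has exactly one vertex disjoint from \<open>S\<close>, add a point of that vertex to \<open>S\<close>. Each
  step kills a color, so \<open>S\<close> never has more points than dead colors. Not all \<open>k + 1\<close> colors can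
  die, because a set of \<open>k + 1\<close> points does not meet all vertices. Hence the process stops with
  \<open>card S \<le> k\<close>, and every color is dead or has two vertices disjoint from \<open>S\<close>. Padding \<open>S\<close> to a
  \<open>k\<close>-set that avoids these pairs of vertices gives a vertex without a uniquely colored neighbor.
  The pairs cover at most \<open>2 * k * (k + 1)\<close> points, so the padding is possible.\<close>

lemma open_nbhd_kneser:
  assumes "S \<in> kneser_verts n k"
  shows "open_nbhd (kneser_verts n k) (kneser_edges n k) S = {A \<in> kneser_verts n k. A \<inter> S = {}}"
  using assms unfolding open_nbhd_def kneser_edges_def
  by (auto simp: doubleton_eq_iff)

lemma kneser_vert_disjoint:
  assumes "finite S" "card S + k \<le> n"
  obtains A where "A \<in> kneser_verts n k" "A \<inter> S = {}"
proof -
  have "n - card S \<le> card ({1..n} - S)"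
    using diff_card_le_card_Diff[OF assms(1), of "{1..n}"] by simp
  with assms(2) obtain A where "A \<subseteq> {1..n} - S" "card A = k"
    by (metis add_le_imp_le_diff add.commute le_trans obtain_subset_with_card_n)
  with that show thesis
    by (auto simp: kneser_verts_def)
qed

lemma finite_kneser_verts: "finite (kneser_verts n k)"
  unfolding kneser_verts_def by (rule finite_subset[of _ "Pow {1..n}"]) auto

lemma cf_coloring_mono:
  assumes "cf_coloring V E m C" "m \<le> m'"
  shows "cf_coloring V E m' C"
  using assms unfolding cf_coloring_def by fastforce

text \<open>The bound on \<open>n\<close> leaves room for two \<open>k\<close>-sets per color and
  for \<open>k\<close> further points.\<close>

lemma not_cf_coloring_kneser:
  assumes k: "k \<ge> 1" and n: "n \<ge> 2 * k * (k + 1) + k"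
  shows "\<not> cf_coloring (kneser_verts n k) (kneser_edges n k) (k + 1) C"
proof
  let ?V = "kneser_verts n k" and ?I = "{1..k + 1}"
  assume cf: "cf_coloring ?V (kneser_edges n k) (k + 1) C"
  have col: "C A \<in> ?I" if "A \<in> ?V" for A
    using cf that by (auto simp: cf_coloring_def)
  define M where "M S i = {A \<in> ?V. A \<inter> S = {} \<and> C A = i}" for S i
  define dead where "dead S = {i \<in> ?I. M S i = {}}" for S
  define P where "P S \<longleftrightarrow> S \<subseteq> {1..n} \<and> card S \<le> card (dead S)" for S
  have "P {}"
    by (simp add: P_def)
  moreover have bound: "card (dead S) < k + 2" for S
    using card_mono[of ?I "dead S"] by (simp add: dead_def subset_iff)
  \<comment> \<open>An extremal choice replaces the process: among the sets satisfying
    \<open>P\<close>, \<open>S\<close> kills the most colors.\<close>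
  ultimately obtain S where S: "P S" and max: "\<And>T. P T \<Longrightarrow> card (dead T) \<le> card (dead S)"
    using ex_has_greatest_nat[of P "{}" "\<lambda>S. card (dead S)" "k + 2"]
    by (metis nless_le)
  have Sn: "S \<subseteq> {1..n}" and finS: "finite S"
    using S finite_subset by (auto simp: P_def)
  have cardS: "card S \<le> k"
  proof (rule ccontr)
    assume "\<not> card S \<le> k"
    then have "card (dead S) = card ?I"
      using S bound[of S] by (simp add: P_def)
    then have all: "dead S = ?I"
      by (intro card_subset_eq) (auto simp: dead_def)
    \<comment> \<open>Since \<open>card S\<close> is at most \<open>k + 1\<close>, it suffices here
      that \<open>n\<close> is at least \<open>2 * k + 1\<close>.\<close>
    have "2 * k * (k + 1) \<ge> 2 * 1 * (k + 1)"
      using k by (intro mult_le_mono) auto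
    then have "card S + k \<le> n"
      using S n bound[of S] by (simp add: P_def)
    then obtain A where A: "A \<in> ?V" "A \<inter> S = {}"
      using kneser_vert_disjoint finS by blast
    then have "A \<in> M S (C A)" "C A \<in> dead S"
      using col[OF A(1)] all by (auto simp: M_def)
    then show False
      by (auto simp: dead_def)
  qed
  have two: "\<exists>A B. A \<in> M S i \<and> B \<in> M S i \<and> A \<noteq> B" if i: "i \<in> ?I - dead S" for i
  proof (rule ccontr)
    assume no: "\<not> ?thesis"
    from i obtain A where A: "A \<in> M S i"
      by (auto simp: dead_def)
    with no have one: "B = A" if "B \<in> M S i" for B
      using that by blast
    have AV: "A \<subseteq> {1..n}" "card A = k"
      using A by (auto simp: M_def kneser_verts_def)
    with k obtain a where a: "a \<in> A"
      by fastforce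
    \<comment> \<open>The only vertex of color \<open>i\<close> avoiding \<open>S\<close> contains
      \<open>a\<close>. So adding \<open>a\<close> kills one more color at the cost of one point,
      against maximality.\<close>
    have "M (insert a S) i = {}"
      using one a by (auto simp: M_def)
    moreover have "dead S \<subseteq> dead (insert a S)"
      by (auto simp: dead_def M_def)
    ultimately have "insert i (dead S) \<subseteq> dead (insert a S)"
      using i by (auto simp: dead_def)
    then have "card (insert i (dead S)) \<le> card (dead (insert a S))"
      by (intro card_mono) (auto simp: dead_def)
    then have less: "card (dead S) < card (dead (insert a S))"
      using i by (simp add: dead_def)
    moreover have "card (insert a S) \<le> Suc (card S)"
      by (simp add: finS card_insert_if)
    ultimately have "P (insert a S)"
      using S a AV by (auto simp: P_def)
    with max less show False
      by (meson not_le)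
  qed
  then obtain A B where AB: "\<And>i. i \<in> ?I - dead S \<Longrightarrow> A i \<in> M S i \<and> B i \<in> M S i \<and> A i \<noteq> B i"
    by metis
  define U where "U = (\<Union>i \<in> ?I - dead S. A i \<union> B i)"
  have "card U \<le> (\<Sum>i \<in> ?I - dead S. card (A i \<union> B i))"
    unfolding U_def by (intro card_UN_le) auto
  also have "\<dots> \<le> (\<Sum>i \<in> ?I - dead S. 2 * k)"
  proof (rule sum_mono)
    fix i assume "i \<in> ?I - dead S"
    then have "card (A i) = k" "card (B i) = k"
      using AB by (auto simp: M_def kneser_verts_def)
    then show "card (A i \<union> B i) \<le> 2 * k"
      using card_Un_le[of "A i" "B i"] by simp
  qed
  also have "\<dots> \<le> 2 * k * (k + 1)"
    using mult_le_mono2[OF card_mono[of ?I "?I - dead S"], of "2 * k"]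
    by (simp add: mult.commute)
  finally have cardU: "card U + k \<le> n"
    using n by simp
  have "A i \<union> B i \<subseteq> {1..n} - S" if "i \<in> ?I - dead S" for i
    using AB[OF that] by (auto simp: M_def kneser_verts_def)
  then have US: "U \<subseteq> {1..n} - S"
    unfolding U_def by (rule UN_least)
  then have "card ({1..n} - U) = n - card U"
    using card_Diff_subset[of U "{1..n}"] finite_subset[of U "{1..n}"] by auto
  then have "k \<le> card ({1..n} - U)"
    using cardU by simp
  \<comment> \<open>The chosen pairs avoid \<open>S\<close>, so \<open>S\<close> itself lies outside
    \<open>U\<close> and can be padded there.\<close>
  moreover have "S \<subseteq> {1..n} - U"
    using US Sn by blast
  ultimately obtain T where T: "S \<subseteq> T" "T \<subseteq> {1..n} - U" "card T = k"
    using exists_subset_between[of S k "{1..n} - U"] cardS by auto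
  then have TV: "T \<in> ?V"
    by (auto simp: kneser_verts_def)
  with cf obtain i where i: "i \<in> ?I"
    and "card (open_nbhd ?V (kneser_edges n k) T \<inter> C -` {i}) = 1"
    unfolding cf_coloring_def by blast
  moreover have "open_nbhd ?V (kneser_edges n k) T \<inter> C -` {i} = M T i"
    using open_nbhd_kneser[OF TV] by (auto simp: M_def)
  ultimately obtain X where X: "M T i = {X}"
    by (auto simp: card_1_singleton_iff)
  \<comment> \<open>The unique neighbor avoids \<open>T\<close> and hence \<open>S\<close>, so its
    color is not dead; but then \<open>A i\<close> and \<open>B i\<close> are two neighbors of that
    color.\<close>
  then have "X \<in> M S i"
    using T(1) by (auto simp: M_def)
  then have i': "i \<in> ?I - dead S"
    using i by (auto simp: dead_def)
  then have "A i \<inter> T = {}" "B i \<inter> T = {}"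
    using T(2) by (auto simp: U_def)
  then have "A i \<in> M T i" "B i \<in> M T i"
    using AB[OF i'] by (auto simp: M_def)
  with X AB[OF i'] show False
    by auto
qed

text \<open>Pairwise distinct colors work once every vertex has a neighbor. This rules out the
  default value \<open>Inf {} = 0\<close> of \<open>chi_CF\<close>.\<close>

lemma ex_cf_coloring_kneser:
  assumes "2 * k \<le> n"
  shows "\<exists>m C. cf_coloring (kneser_verts n k) (kneser_edges n k) m C"
proof -
  let ?V = "kneser_verts n k"
  obtain C where C: "bij_betw C ?V {1..card ?V}"
    using finite_same_card_bij[OF finite_kneser_verts, of "{1..card ?V}"] by auto
  have "\<exists>i\<in>{1..card ?V}. card (open_nbhd ?V (kneser_edges n k) S \<inter> C -` {i}) = 1"
    if S: "S \<in> ?V" for S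
  proof -
    have "finite S" "card S = k"
      using S finite_subset by (auto simp: kneser_verts_def)
    then obtain A where A: "A \<in> ?V" "A \<inter> S = {}"
      using kneser_vert_disjoint[of S k n] assms by auto
    have "open_nbhd ?V (kneser_edges n k) S \<inter> C -` {C A} = {A}"
      using A C unfolding open_nbhd_kneser[OF S] bij_betw_def inj_on_def by blast
    moreover have "C A \<in> {1..card ?V}"
      using A C by (auto simp: bij_betw_def)
    ultimately show ?thesis
      by (intro bexI[of _ "C A"]) simp_all
  qed
  then have "cf_coloring ?V (kneser_edges n k) (card ?V) C"
    using C by (auto simp: cf_coloring_def bij_betw_def)
  then show ?thesis
    by blast
qed

theorem theorem5:
  fixes n k :: nat
  assumes "k \<ge> 1"
    and "n \<ge> k * (k + 1)\<^sup>2 + 1"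
  shows "\<not> (\<exists>C. cf_coloring (kneser_verts n k) (kneser_edges n k) (k + 1) C)
    \<and> chi_CF (kneser_verts n k) (kneser_edges n k) \<ge> k + 2"
proof -
  let ?cf = "cf_coloring (kneser_verts n k) (kneser_edges n k)"
  \<comment> \<open>This is the difference of the two bounds on \<open>n\<close>; equality holds at
    \<open>k = 1\<close>.\<close>
  have "2 * k \<le> k * k * k + 1"
  proof (cases "k = 1")
    case False
    then have "2 * 1 * k \<le> k * k * k"
      using assms(1) by (intro mult_le_mono) auto
    then show ?thesis
      by linarith
  qed simp
  moreover have "k * (k + 1)\<^sup>2 = k * k * k + 2 * (k * k) + k"
    by (simp add: power2_eq_square algebra_simps)
  moreover have "2 * k * (k + 1) + k = 2 * (k * k) + 3 * k"
    by (simp add: algebra_simps)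
  ultimately have n: "n \<ge> 2 * k * (k + 1) + k"
    using assms(2) by linarith
  have no: "\<not> ?cf (k + 1) C" for C
    using not_cf_coloring_kneser[OF assms(1) n] .
  have "2 * k \<le> n"
    using n by (simp add: algebra_simps)
  then have "{m. \<exists>C. ?cf m C} \<noteq> {}"
    using ex_cf_coloring_kneser by blast
  then have "Inf {m. \<exists>C. ?cf m C} \<in> {m. \<exists>C. ?cf m C}"
    by (rule Inf_nat_def1)
  then obtain C where "?cf (chi_CF (kneser_verts n k) (kneser_edges n k)) C"
    by (auto simp: chi_CF_def)
  then have "chi_CF (kneser_verts n k) (kneser_edges n k) \<ge> k + 2"
    using no cf_coloring_mono by (metis add_2_eq_Suc' Suc_eq_plus1 not_less_eq_eq)
  with no show ?thesis
    by blast
qed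

end
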